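(* Let $m$ and $k$ be positive integers, let $X_m\subseteq\{0,1,\dots,m-1\}$, let $Y^{(0)}$ be a finite set of negative integers with $Y^{(0)}\pmod{m}\subseteq X_m$, and let $Y^{(1)}$ be a set of integers with $\big(Y^{(1)}\pmod{m}\big)\cap X_m=\emptyset$. Let $$W=(m\mathbb{N}+X_m)\cup Y^{(0)}\cup Y^{(1)}.$$ If $Y^{(1)}=D+mk\mathbb{N}$ for some set of integers $D\subseteq[0,m-1]$, then the set $W$ does not have a minimal additive complement.
   Context: $\mathbb{N}=\{0,1,2,\dots\}$. For $A,B\subseteq\mathbb{Z}$ and $c\in\mathbb{Z}$, $A+B=\{a+b: a\in A,\ b\in B\}$ and $cA=\{ca: a\in A\}$. For a positive integer $m$ and a set $A$ of integers, $$A\pmod{m}=\{i\in\{0,1,\dots,m-1\}: i\equiv a \pmod{m}\text{ for some }a\in A\}.$$ For $C,W\subseteq\mathbb{Z}$, the set $C$ is called an additive complement to $W$ if $C+W=\mathbb{Z}$. An additive complement $C$ to $W$ is called a minimal additive complement to $W$ if no proper subset of $C$ is an additive complement to $W$. *)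

theory Defs
  imports Complex_Main "HOL-Library.Set_Algebras"
begin

text \<open>
  Sumsets \<open>A + B\<close> and dilates \<open>c *o A\<close> are those of \<^theory>\<open>HOL-Library.Set_Algebras\<close>;
  \<open>\<nat> :: int set\<close> is the set of non-negative integers, with \<open>0\<close> included.
\<close>

definition residues_of :: "int set \<Rightarrow> int \<Rightarrow> int set" where
  "residues_of A m = {i \<in> {0..m - 1}. \<exists>a\<in>A. i mod m = a mod m}"

definition additive_complement :: "int set \<Rightarrow> int set \<Rightarrow> bool" where
  "additive_complement C W \<longleftrightarrow> C + W = UNIV"

definition minimal_additive_complement :: "int set \<Rightarrow> int set \<Rightarrow> bool" where
  "minimal_additive_complement C W \<longleftrightarrow>
     additive_complement C W \<and> (\<forall>C'. C' \<subset> C \<longrightarrow> \<not> additive_complement C' W)"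

end

theory Submission
  imports Defs
begin

text \<open>
  The set \<open>W\<close> is bounded below and absorbs translation by every large multiple of \<open>M = m k\<close>.
  A complement \<open>C\<close> is therefore unbounded below, and by pigeonhole it contains \<open>c\<close> and \<open>c'\<close> in the
  same class modulo \<open>M\<close> with \<open>c'\<close> far below \<open>c\<close>. Then \<open>c + W \<subseteq> c' + W\<close>, so \<open>c\<close> is redundant.
\<close>

lemma infinite_additive_complement_atMost:
  assumes C: "additive_complement C W" and bdd: "\<And>w. w \<in> W \<Longrightarrow> b \<le> w"
  shows "infinite (C \<inter> {..0})"
proof
  assume fin: "finite (C \<inter> {..0})"
  obtain l where l: "\<And>c. c \<in> C \<inter> {..0} \<Longrightarrow> l \<le> c"
    using bdd_below_finite[OF fin] unfolding bdd_below_def by blast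
  \<comment> \<open>Every \<open>w\<close> is at least \<open>b\<close>, so any \<open>c\<close>
    with \<open>c + w = n\<close> is at most \<open>min l 0 - 1\<close>. It is then negative, hence
    in \<open>C \<inter> {..0}\<close>, yet below the lower bound \<open>l\<close> of that
    set.\<close>
  define n where "n = min l 0 - 1 + b"
  have "n \<in> C + W" using C by (simp add: additive_complement_def)
  then obtain c w where cw: "c \<in> C" "w \<in> W" "n = c + w" by (auto elim: set_plus_elim)
  with bdd[of w] have "c \<le> min l 0 - 1" unfolding n_def by linarith
  with l[of c] cw(1) show False by auto
qed

text \<open>Isolates the two properties of \<open>W\<close> that drive the argument: a lower bound,
  and closure under large shifts by multiples of \<open>M\<close>.\<close>

lemma no_minimal_additive_complement:
  fixes M b B :: int
  assumes "M > 0" and bdd: "\<And>w. w \<in> W \<Longrightarrow> b \<le> w"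
    and shift: "\<And>w j. w \<in> W \<Longrightarrow> j \<ge> B \<Longrightarrow> M dvd j \<Longrightarrow> w + j \<in> W"
  shows "\<not> minimal_additive_complement C W"
proof
  assume min: "minimal_additive_complement C W"
  then have C: "additive_complement C W" by (simp add: minimal_additive_complement_def)
  let ?N = "C \<inter> {..0}"
  have "(\<lambda>c. c mod M) ` ?N \<subseteq> {0..<M}" using \<open>M > 0\<close> by auto
  then have "finite ((\<lambda>c. c mod M) ` ?N)" by (rule finite_subset) simp
  with infinite_additive_complement_atMost[OF C bdd]
  obtain c where c: "c \<in> ?N" and inf: "infinite {a \<in> ?N. a mod M = c mod M}"
    using pigeonhole_infinite by blast
  \<comment> \<open>An infinite set does not fit in a bounded interval. In \<open>max B 1\<close>,
    the \<open>B\<close> makes the gap \<open>c - c'\<close> large enough for \<open>shift\<close>,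
    and the 1 forces \<open>c'\<close> to differ from \<open>c\<close>.\<close>
  have "\<not> {a \<in> ?N. a mod M = c mod M} \<subseteq> {c - max B 1 <.. 0}"
    using inf finite_subset by blast
  then obtain c' where "c' \<in> ?N" "c' mod M = c mod M" "c' \<notin> {c - max B 1 <.. 0}" by blast
  then have c': "c' \<in> C" "c' mod M = c mod M" "c' \<le> c - max B 1" by auto
  have dvd: "M dvd c - c'" using c'(2) by (metis mod_eq_dvd_iff)
  have "n \<in> (C - {c}) + W" for n
  proof -
    have "n \<in> C + W" using C by (simp add: additive_complement_def)
    then obtain a w where aw: "a \<in> C" "w \<in> W" "n = a + w" by (auto elim: set_plus_elim)
    show ?thesis
    proof (cases "a = c")
      case True
      \<comment> \<open>Since \<open>c + w = c' + (w + (c - c'))\<close>, a representation through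
        \<open>c\<close> can be rerouted through \<open>c'\<close>.\<close>
      have "w + (c - c') \<in> W" using shift[OF aw(2) _ dvd] c'(3) by simp
      moreover have "c' \<in> C - {c}" using c' by auto
      ultimately have "c' + (w + (c - c')) \<in> (C - {c}) + W" by (rule set_plus_intro[rotated])
      then show ?thesis using True aw(3) by (simp add: algebra_simps)
    next
      case False
      then show ?thesis using aw by (auto intro: set_plus_intro)
    qed
  qed
  then have "additive_complement (C - {c}) W" by (auto simp: additive_complement_def)
  moreover have "C - {c} \<subset> C" using c by auto
  ultimately show False using min by (simp add: minimal_additive_complement_def)
qed

text \<open>Turns membership in a union of one-sided progressions into an order and a divisibility
  condition, both easy to follow under shifts. The condition \<open>s \<le> x\<close> is what makes
  the quotient a natural number.\<close>

lemma mem_dilate_Nats_plus_iff: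
  fixes a :: int
  assumes "a > 0"
  shows "x \<in> a *o \<nat> + S \<longleftrightarrow> (\<exists>s\<in>S. s \<le> x \<and> a dvd x - s)"
proof
  assume "x \<in> a *o \<nat> + S"
  then obtain n s where "s \<in> S" "x = a * int n + s"
    by (auto simp: elt_set_times_def Nats_def elim!: set_plus_elim)
  then show "\<exists>s\<in>S. s \<le> x \<and> a dvd x - s" using assms by (intro bexI[of _ s]) auto
next
  assume "\<exists>s\<in>S. s \<le> x \<and> a dvd x - s"
  then obtain s q where s: "s \<in> S" "s \<le> x" "x - s = a * q" unfolding dvd_def by blast
  then have "q \<ge> 0" using assms by (metis diff_ge_0_iff_ge zero_le_mult_iff not_less)
  then have "q \<in> \<nat>" by (metis Nats_def nat_0_le rangeI)
  then have "a * q \<in> a *o \<nat>" by (auto simp: elt_set_times_def)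
  from set_plus_intro[OF this s(1)] s(3) show "x \<in> a *o \<nat> + S" by (simp add: algebra_simps)
qed

theorem theorem2:
  fixes m k :: int and X Y0 Y1 W :: "int set"
  assumes "m > 0" and "k > 0"
    and "X \<subseteq> {0..m - 1}"
    and "finite Y0" and "\<forall>y\<in>Y0. y < 0" and "residues_of Y0 m \<subseteq> X"
    and "residues_of Y1 m \<inter> X = {}"
    and "W = (m *o \<nat> + X) \<union> Y0 \<union> Y1"
    and "\<exists>D. D \<subseteq> {0..m - 1} \<and> Y1 = D + (m * k) *o \<nat>"
  shows "\<not> (\<exists>C. minimal_additive_complement C W)"
proof -
  obtain D where D: "D \<subseteq> {0..m - 1}" "Y1 = D + (m * k) *o \<nat>" using assms(9) by blast
  have mk: "m * k > 0" using assms(1,2) by simp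
  have memX: "x \<in> m *o \<nat> + X \<longleftrightarrow> (\<exists>s\<in>X. s \<le> x \<and> m dvd x - s)" for x
    by (rule mem_dilate_Nats_plus_iff[OF assms(1)])
  have memY1: "x \<in> Y1 \<longleftrightarrow> (\<exists>d\<in>D. d \<le> x \<and> m * k dvd x - d)" for x
    unfolding D(2) add.commute[of D] by (rule mem_dilate_Nats_plus_iff[OF mk])
  obtain l where l: "\<And>y. y \<in> Y0 \<Longrightarrow> l \<le> y"
    using bdd_below_finite[OF assms(4)] unfolding bdd_below_def by blast
  \<comment> \<open>The term \<open>m - l\<close> lifts every element of \<open>Y0\<close> to at
    least \<open>m\<close>, beyond all residues; the 0 keeps shifts of the progressions from going
    left of their starting points.\<close>
  define B where "B = max 0 (m - l)"
  have "\<not> minimal_additive_complement C W" for C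
  proof (rule no_minimal_additive_complement[OF mk])
    fix w assume "w \<in> W"
    \<comment> \<open>Both progressions start in \<open>{0..m - 1}\<close>, so negative elements
      come only from \<open>Y0\<close>.\<close>
    then consider "w \<in> Y0" | "0 \<le> w"
      using assms(3,8) D(1) memX memY1 by fastforce
    then show "min l 0 \<le> w" using l by cases force+
  next
    fix w j assume w: "w \<in> W" and j: "B \<le> j" "m * k dvd j"
    have "0 \<le> j" "m - l \<le> j" using j(1) by (auto simp: B_def)
    have mj: "m dvd j" using j(2) by (rule dvd_mult_left)
    consider "w \<in> m *o \<nat> + X" | "w \<in> Y0" | "w \<in> Y1" using w assms(8) by blast
    then show "w + j \<in> W"
    proof cases
      case 1
      then obtain s where "s \<in> X" "s \<le> w" "m dvd w - s" using memX by blast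
      then have "s \<le> w + j" "m dvd (w + j) - s"
        using \<open>0 \<le> j\<close> dvd_add[OF _ mj, of "w - s"] by (auto simp: algebra_simps)
      then show ?thesis using memX \<open>s \<in> X\<close> assms(8) by blast
    next
      case 2
      \<comment> \<open>A shifted element of \<open>Y0\<close> lands in
        \<open>m *o \<nat> + X\<close>: its residue lies in \<open>X\<close>, and the shift carries
        it past that residue.\<close>
      have "w mod m \<in> residues_of Y0 m"
        using 2 assms(1) by (auto simp: residues_of_def)
      then have "w mod m \<in> X" using assms(6) by blast
      moreover have "w mod m \<le> w + j"
        using l[OF 2] \<open>m - l \<le> j\<close> pos_mod_bound[OF assms(1), of w] by linarith
      moreover have "m dvd (w + j) - w mod m"
        using dvd_add[OF dvd_minus_mod[of m w] mj] by (simp add: algebra_simps)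
      ultimately show ?thesis using memX assms(8) by blast
    next
      case 3
      then obtain d where "d \<in> D" "d \<le> w" "m * k dvd w - d" using memY1 by blast
      then have "d \<le> w + j" "m * k dvd (w + j) - d"
        using \<open>0 \<le> j\<close> dvd_add[OF _ j(2), of "w - d"] by (auto simp: algebra_simps)
      then show ?thesis using memY1 \<open>d \<in> D\<close> assms(8) by blast
    qed
  qed
  then show ?thesis by blast
qed

end
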